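(* For every integer $n\geq 2$, \[ U_n=T_n^\perp . \] In other words, a function $f:S_n\to\mathbb R$ belongs to $U_n$ if and only if $\sum_{\sigma\in L}f(\sigma)$ is independent of the one-factorization $L\in\mathcal L_n$. Equivalently, this holds if and only if there are $c\in\mathbb R$ and $a_{i,j}\in\mathbb R$ ($i,j\in[n]$) such that \[ f(\sigma)=c+\sum_{i=1}^n a_{i,\sigma(i)}\qquad(\sigma\in S_n). \]
   Context: $S_n$ is the symmetric group on $[n]=\{1,\ldots,n\}$. Two permutations $\sigma,\tau\in S_n$ are disjoint if $\sigma(i)\neq\tau(i)$ for every $i\in[n]$. A one-factorization is a set $L\subseteq S_n$ of $n$ pairwise disjoint permutations; $\mathcal L_n$ is the set of all one-factorizations. For $i,j\in[n]$, $x_{i,j}:S_n\to\mathbb R$ is the function with $x_{i,j}(\sigma)=1$ if $\sigma(i)=j$ and $0$ otherwise, and $U_n=\operatorname{span}_{\mathbb R}\{x_{i,j}:i,j\in[n]\}$. The space $\mathbb R^{S_n}$ carries the inner product $\langle f,g\rangle=\sum_{\sigma\in S_n}f(\sigma)g(\sigma)$. For $L\in\mathcal L_n$, $v_L=\mathbf 1_L\in\mathbb R^{S_n}$ is the indicator function of $L$, and $T_n=\operatorname{span}_{\mathbb R}\{v_L-v_{L'}:L,L'\in\mathcal L_n\}$; $T_n^\perp$ is its orthogonal complement in $\mathbb R^{S_n}$. *)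

theory Defs
  imports
    Complex_Main
    "HOL-Library.Function_Algebras"
    "HOL-Library.Indicator_Function"
    "HOL-Combinatorics.Permutations"
begin

text \<open>Pointwise real vector space structure on functions, so that the library's
  \<^const>\<open>span\<close> applies; addition is pointwise by \<^theory>\<open>HOL-Library.Function_Algebras\<close>.\<close>

instantiation "fun" :: (type, real_vector) real_vector
begin

definition scaleR_fun :: "real \<Rightarrow> ('a \<Rightarrow> 'b) \<Rightarrow> 'a \<Rightarrow> 'b" where
  "scaleR_fun r f = (\<lambda>x. r *\<^sub>R f x)"

instance
  by standard (simp_all add: scaleR_fun_def fun_eq_iff algebra_simps)

end

definition Sym :: "nat \<Rightarrow> (nat \<Rightarrow> nat) set" where
  "Sym n = {\<sigma>. \<sigma> permutes {1..n}}"

text \<open>A real function on \<^term>\<open>Sym n\<close> is encoded as the total function that extends it by 0.\<close>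

definition fun_space :: "nat \<Rightarrow> ((nat \<Rightarrow> nat) \<Rightarrow> real) set" where
  "fun_space n = {f. \<forall>\<sigma>. \<sigma> \<notin> Sym n \<longrightarrow> f \<sigma> = 0}"

definition inner_Sym :: "nat \<Rightarrow> ((nat \<Rightarrow> nat) \<Rightarrow> real) \<Rightarrow> ((nat \<Rightarrow> nat) \<Rightarrow> real) \<Rightarrow> real" where
  "inner_Sym n f g = (\<Sum>\<sigma>\<in>Sym n. f \<sigma> * g \<sigma>)"

definition orth_Sym ::
    "nat \<Rightarrow> ((nat \<Rightarrow> nat) \<Rightarrow> real) set \<Rightarrow> ((nat \<Rightarrow> nat) \<Rightarrow> real) set" where
  "orth_Sym n W = {f \<in> fun_space n. \<forall>g\<in>W. inner_Sym n f g = 0}"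

definition disjoint_perms :: "nat \<Rightarrow> (nat \<Rightarrow> nat) \<Rightarrow> (nat \<Rightarrow> nat) \<Rightarrow> bool" where
  "disjoint_perms n \<sigma> \<tau> \<longleftrightarrow> (\<forall>i\<in>{1..n}. \<sigma> i \<noteq> \<tau> i)"

definition one_factorizations :: "nat \<Rightarrow> (nat \<Rightarrow> nat) set set" where
  "one_factorizations n =
     {L. L \<subseteq> Sym n \<and> card L = n \<and> pairwise (disjoint_perms n) L}"

definition x_fun :: "nat \<Rightarrow> nat \<Rightarrow> nat \<Rightarrow> (nat \<Rightarrow> nat) \<Rightarrow> real" where
  "x_fun n i j = (\<lambda>\<sigma>. if \<sigma> \<in> Sym n \<and> \<sigma> i = j then 1 else 0)"

definition U_space :: "nat \<Rightarrow> ((nat \<Rightarrow> nat) \<Rightarrow> real) set" where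
  "U_space n = span {x_fun n i j | i j. i \<in> {1..n} \<and> j \<in> {1..n}}"

definition T_space :: "nat \<Rightarrow> ((nat \<Rightarrow> nat) \<Rightarrow> real) set" where
  "T_space n = span {indicator L - indicator L' | L L'.
     L \<in> one_factorizations n \<and> L' \<in> one_factorizations n}"

end

theory Submission
  imports Defs "HOL-Combinatorics.Cycles"
begin

text \<open>
  Let \<open>f\<close> have the same sum over all one-factorizations. By Hall's theorem any two disjoint
  permutations lie in a common one-factorization, and exchanging the values of two rows on a common
  block gives \<open>f(\<sigma>) + f(\<sigma>\<alpha>\<beta>) = f(\<sigma>\<alpha>) + f(\<sigma>\<beta>)\<close> whenever \<open>\<alpha> = (a b)\<close> and \<open>\<beta>\<close> is a derangement
  of the complement of \<open>{a, b}\<close>. Thus \<open>f(\<sigma>) - f(\<sigma>(a b))\<close> is invariant under such \<open>\<beta>\<close>, hence (with an extra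
  parity argument for \<open>n = 5\<close>) under the full symmetric group of the complement, and is a function
  \<open>g\<^sub>a\<^sub>b(\<sigma>(a), \<sigma>(b))\<close>. The braid relation \<open>(a b)(b c)(a b) = (a c)\<close> forces \<open>g\<^sub>a\<^sub>b\<close> to be a coboundary, i.e.
  \<open>g\<^sub>a\<^sub>b(x, y) = A\<^sub>a(x) - A\<^sub>a(y) - A\<^sub>b(x) + A\<^sub>b(y)\<close>. Then \<open>f(\<sigma>) - \<Sum>\<^sub>i A\<^sub>i(\<sigma>(i))\<close> is invariant under all
  transpositions and therefore constant.
\<close>

section \<open>Completion of Latin rectangles\<close>

text \<open>The Halmos-Vaughan induction. If some proper nonempty J is tight, J is matched inside
  its own neighbourhood and the rest outside it. Otherwise every proper nonempty subset has a spare
  neighbour, so one pair may be fixed arbitrarily.\<close>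

lemma hall_marriage:
  fixes A :: "'a \<Rightarrow> 'b set"
  assumes "finite I" and "\<And>i. i \<in> I \<Longrightarrow> finite (A i)"
    and "\<And>J. J \<subseteq> I \<Longrightarrow> card J \<le> card (\<Union>(A ` J))"
  shows "\<exists>f. inj_on f I \<and> (\<forall>i\<in>I. f i \<in> A i)"
  using assms
proof (induction "card I" arbitrary: I A rule: less_induct)
  case less
  note fin = less.prems(1) and finA = less.prems(2) and hall = less.prems(3)
  have finU: "finite (\<Union>(A ` J))" if "J \<subseteq> I" for J
    using that fin finA by (meson finite_UN_I finite_subset subsetD)
  show ?case
  proof (cases "\<exists>J. J \<noteq> {} \<and> J \<subset> I \<and> card (\<Union>(A ` J)) = card J")
    case True
    then obtain J where J: "J \<noteq> {}" "J \<subset> I" and tight: "card (\<Union>(A ` J)) = card J"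
      by blast
    have finJ: "finite J" using J fin finite_subset by blast
    have "\<exists>f. inj_on f J \<and> (\<forall>i\<in>J. f i \<in> A i)"
    proof (rule less.hyps)
      show "card J < card I" using J(2) fin by (rule psubset_card_mono[rotated])
      show "finite (A i)" if "i \<in> J" for i using that J finA by blast
      show "card K \<le> card (\<Union>(A ` K))" if "K \<subseteq> J" for K
        using that J by (intro hall) auto
    qed (rule finJ)
    then obtain f where f: "inj_on f J" "\<forall>i\<in>J. f i \<in> A i" by blast
    define B where "B i = A i - \<Union>(A ` J)" for i
    have "\<exists>g. inj_on g (I - J) \<and> (\<forall>i\<in>I - J. g i \<in> B i)"
    proof (rule less.hyps)
      show "card (I - J) < card I"
        using J fin by (intro psubset_card_mono) auto
      show "finite (I - J)" using fin by simp
      show "finite (B i)" if "i \<in> I - J" for i using that finA unfolding B_def by simp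
      fix K assume K: "K \<subseteq> I - J"
      have finK: "finite K" using K fin finite_subset by blast
      \<comment> \<open>As J is tight, removing its neighbourhood costs exactly
        \<open>card J\<close> elements, so Hall's condition for \<open>J \<union> K\<close> leaves
        at least \<open>card K\<close>.\<close>
      have eq: "\<Union>(B ` K) = \<Union>(A ` (J \<union> K)) - \<Union>(A ` J)" unfolding B_def by auto
      have "card J + card K = card (J \<union> K)"
        using K finJ finK by (subst card_Un_disjoint) auto
      also have "\<dots> \<le> card (\<Union>(A ` (J \<union> K)))" using K J by (intro hall) auto
      finally show "card K \<le> card (\<Union>(B ` K))"
        unfolding eq using J tight finU[of J] by (subst card_Diff_subset) auto
    qed
    then obtain g where g: "inj_on g (I - J)" "\<forall>i\<in>I - J. g i \<in> B i" by blast
    define h where "h i = (if i \<in> J then f i else g i)" for i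
    have "g u \<noteq> f v" if "u \<in> I - J" "v \<in> J" for u v
      using f(2) g(2) that unfolding B_def by (metis DiffD2 UN_I)
    then have "inj_on h (J \<union> (I - J))"
      unfolding inj_on_Un using f(1) g(1) inj_on_cong[of J h f] inj_on_cong[of "I - J" h g]
      by (simp add: h_def) fastforce
    then have "inj_on h I" using J(2) by (simp add: Un_absorb1 psubset_imp_subset)
    moreover have "\<forall>i\<in>I. h i \<in> A i"
      using f g unfolding h_def B_def by auto
    ultimately show ?thesis by blast
  next
    case loose: False
    show ?thesis
    proof (cases "I = {}")
      case True
      then show ?thesis by simp
    next
      case nonempty: False
      then obtain i where i: "i \<in> I" by blast
      have "card {i} \<le> card (\<Union>(A ` {i}))" using i by (intro hall) auto
      then obtain x where x: "x \<in> A i" by fastforce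
      define B where "B j = A j - {x}" for j
      have "\<exists>g. inj_on g (I - {i}) \<and> (\<forall>j\<in>I - {i}. g j \<in> B j)"
      proof (rule less.hyps)
        show "card (I - {i}) < card I" using i by (rule card_Diff1_less[OF fin])
        show "finite (I - {i})" using fin by simp
        show "finite (B j)" if "j \<in> I - {i}" for j using that finA unfolding B_def by simp
        fix K assume K: "K \<subseteq> I - {i}"
        show "card K \<le> card (\<Union>(B ` K))"
        proof (cases "K = {}")
          case False
          \<comment> \<open>Without tight sets the inequality for K is strict, which absorbs the
            loss of x.\<close>
          have "K \<subset> I" using K i by auto
          then have "card K \<noteq> card (\<Union>(A ` K))" "card K \<le> card (\<Union>(A ` K))"
            using loose hall[OF psubset_imp_subset] False by metis+
          moreover have "\<Union>(B ` K) = \<Union>(A ` K) - {x}" unfolding B_def by auto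
          ultimately show ?thesis
            by (simp only: card_Diff_singleton_if) (simp, linarith)
        qed simp
      qed
      then obtain g where g: "inj_on g (I - {i})" "\<forall>j\<in>I - {i}. g j \<in> B j" by blast
      have "x \<notin> g ` (I - {i})" using g(2) unfolding B_def by auto
      then have "inj_on (g(i := x)) I"
        by (subst insert_Diff[OF i, symmetric], unfold inj_on_insert)
          (simp add: inj_on_fun_updI[OF g(1)])
      moreover have "\<forall>j\<in>I. (g(i := x)) j \<in> A j" using g(2) x unfolding B_def by auto
      ultimately show ?thesis by blast
    qed
  qed
qed

section \<open>The symmetric group and the extension of Latin rectangles by rows\<close>

lemma finite_Sym [simp]: "finite (Sym n)"
  unfolding Sym_def by (rule finite_permutations) simp

lemma Sym_comp: "\<sigma> \<in> Sym n \<Longrightarrow> \<tau> \<in> Sym n \<Longrightarrow> \<sigma> \<circ> \<tau> \<in> Sym n"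
  unfolding Sym_def by (simp add: permutes_compose)

lemma Sym_transpose: "a \<in> {1..n} \<Longrightarrow> b \<in> {1..n} \<Longrightarrow> transpose a b \<in> Sym n"
  unfolding Sym_def by (simp add: permutes_swap_id)

lemma Sym_in_iff: "\<sigma> \<in> Sym n \<Longrightarrow> \<sigma> i \<in> {1..n} \<longleftrightarrow> i \<in> {1..n}"
  unfolding Sym_def by (simp add: permutes_in_image del: atLeastAtMost_iff)

lemma Sym_inj_iff: "\<sigma> \<in> Sym n \<Longrightarrow> \<sigma> i = \<sigma> j \<longleftrightarrow> i = j"
  unfolding Sym_def by (metis injD mem_Collect_eq permutes_inj)

lemma pairwise_disjoint_permsD:
  "pairwise (disjoint_perms n) R \<Longrightarrow> \<rho> \<in> R \<Longrightarrow> \<rho>' \<in> R \<Longrightarrow> i \<in> {1..n} \<Longrightarrow> \<rho> i = \<rho>' i \<Longrightarrow> \<rho> = \<rho>'"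
  unfolding pairwise_def disjoint_perms_def by blast

lemma latin_rectangle_extend_row:
  assumes R: "R \<subseteq> Sym n" "pairwise (disjoint_perms n) R" and k: "card R < n"
  shows "\<exists>\<sigma>\<in>Sym n. \<forall>\<rho>\<in>R. disjoint_perms n \<sigma> \<rho>"
proof -
  define A where "A i = {1..n} - (\<lambda>\<rho>. \<rho> i) ` R" for i
  have finR: "finite R" using R finite_Sym finite_subset by blast
  have cardA: "n - card R \<le> card (A i)" for i
    unfolding A_def using diff_card_le_card_Diff[of "(\<lambda>\<rho>. \<rho> i) ` R" "{1..n}"]
      card_image_le[OF finR, of "\<lambda>\<rho>. \<rho> i"] finR by simp
  have col: "card {i \<in> {1..n}. j \<in> A i} \<le> n - card R" if j: "j \<in> {1..n}" for j
  proof -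
    have inv: "inv \<rho> j \<in> {1..n}" "\<rho> (inv \<rho> j) = j" if "\<rho> \<in> R" for \<rho>
    proof -
      have p: "\<rho> permutes {1..n}" using that R(1) unfolding Sym_def by blast
      show "inv \<rho> j \<in> {1..n}" using j permutes_in_image[OF permutes_inv[OF p]] by blast
      show "\<rho> (inv \<rho> j) = j" by (rule permutes_inverses(1)[OF p])
    qed
    \<comment> \<open>Two rows with the value j in the same position would not be disjoint, so j is
      blocked in at least \<open>card R\<close> positions.\<close>
    have "inj_on (\<lambda>\<rho>. inv \<rho> j) R"
    proof (rule inj_onI)
      fix \<rho> \<rho>' assume "\<rho> \<in> R" "\<rho>' \<in> R" "inv \<rho> j = inv \<rho>' j"
      then show "\<rho> = \<rho>'"
        using pairwise_disjoint_permsD[OF R(2) _ _ inv(1)] inv(2) by metis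
    qed
    then have card: "card ((\<lambda>\<rho>. inv \<rho> j) ` R) = card R" by (rule card_image)
    have "{i \<in> {1..n}. j \<in> A i} \<subseteq> {1..n} - (\<lambda>\<rho>. inv \<rho> j) ` R"
    proof
      fix i assume i: "i \<in> {i \<in> {1..n}. j \<in> A i}"
      have "i \<noteq> inv \<rho> j" if "\<rho> \<in> R" for \<rho>
      proof
        assume eq: "i = inv \<rho> j"
        have "\<rho> i \<in> (\<lambda>\<rho>. \<rho> i) ` R" using that by (rule imageI)
        then show False using i inv(2)[OF that] eq unfolding A_def by simp
      qed
      then show "i \<in> {1..n} - (\<lambda>\<rho>. inv \<rho> j) ` R" using i by blast
    qed
    then have "card {i \<in> {1..n}. j \<in> A i} \<le> card ({1..n} - (\<lambda>\<rho>. inv \<rho> j) ` R)"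
      by (rule card_mono[rotated]) simp
    also have "\<dots> = n - card R"
      using inv(1) finR card by (subst card_Diff_subset) auto
    finally show ?thesis .
  qed
  have "\<exists>f. inj_on f {1..n} \<and> (\<forall>i\<in>{1..n}. f i \<in> A i)"
  proof (rule hall_marriage)
    fix J assume J: "J \<subseteq> {1..n}"
    have finJ: "finite J" using J finite_subset by blast
    let ?U = "\<Union>(A ` J)"
    have U: "?U \<subseteq> {1..n}" unfolding A_def by blast
    then have finU: "finite ?U" by (rule finite_subset) simp
    \<comment> \<open>The admissible pairs (i, j) with i in J are counted by positions and then by
      values; the positive factor \<open>n - card R\<close> cancels at the end.\<close>
    have "(n - card R) * card J \<le> (\<Sum>i\<in>J. card (A i))"
      using sum_mono[of J "\<lambda>_. n - card R" "\<lambda>i. card (A i)"] cardA by (simp add: mult.commute)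
    also have "\<dots> = (\<Sum>i\<in>J. \<Sum>j\<in>?U. of_bool (j \<in> A i))"
    proof (rule sum.cong)
      fix i assume "i \<in> J"
      then have "?U \<inter> A i = A i" by blast
      then show "card (A i) = (\<Sum>j\<in>?U. of_bool (j \<in> A i))"
        using finU by (simp add: of_bool_def sum.If_cases)
    qed simp
    also have "\<dots> = (\<Sum>j\<in>?U. \<Sum>i\<in>J. of_bool (j \<in> A i))" by (rule sum.swap)
    also have "\<dots> = (\<Sum>j\<in>?U. card {i \<in> J. j \<in> A i})"
      using finJ by (simp add: of_bool_def sum.If_cases Int_def)
    also have "\<dots> \<le> (\<Sum>j\<in>?U. n - card R)"
    proof (rule sum_mono)
      fix j assume "j \<in> ?U"
      then have "card {i \<in> {1..n}. j \<in> A i} \<le> n - card R" using U by (intro col) blast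
      moreover have "card {i \<in> J. j \<in> A i} \<le> card {i \<in> {1..n}. j \<in> A i}"
        using J by (intro card_mono) auto
      ultimately show "card {i \<in> J. j \<in> A i} \<le> n - card R" by simp
    qed
    finally show "card J \<le> card ?U" using k by (simp add: mult.commute)
  qed (auto simp: A_def)
  then obtain f where f: "inj_on f {1..n}" "\<forall>i\<in>{1..n}. f i \<in> A i" by blast
  define \<sigma> where "\<sigma> i = (if i \<in> {1..n} then f i else i)" for i
  have "\<sigma> permutes {1..n}"
  proof (rule inj_imp_permutes)
    show "inj_on \<sigma> {1..n}" using f(1) by (subst inj_on_cong[of _ \<sigma> f]) (simp_all add: \<sigma>_def)
    show "\<sigma> i \<in> {1..n}" if "i \<in> {1..n}" for i
      using bspec[OF f(2) that] that unfolding \<sigma>_def A_def by simp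
  qed (auto simp: \<sigma>_def)
  moreover have "disjoint_perms n \<sigma> \<rho>" if "\<rho> \<in> R" for \<rho>
    unfolding disjoint_perms_def
  proof
    fix i assume i: "i \<in> {1..n}"
    then show "\<sigma> i \<noteq> \<rho> i" using bspec[OF f(2) i] that unfolding \<sigma>_def A_def by auto
  qed
  ultimately show ?thesis unfolding Sym_def by blast
qed

lemma disjoint_perms_sym: "disjoint_perms n \<sigma> \<tau> \<Longrightarrow> disjoint_perms n \<tau> \<sigma>"
  unfolding disjoint_perms_def by metis

lemma latin_rectangle_extend:
  assumes "R \<subseteq> Sym n" "pairwise (disjoint_perms n) R" "card R \<le> n"
  shows "\<exists>L\<in>one_factorizations n. R \<subseteq> L"
  using assms
proof (induction "n - card R" arbitrary: R)
  case 0
  then show ?case unfolding one_factorizations_def by auto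
next
  case (Suc k)
  have finR: "finite R" using Suc.prems finite_Sym finite_subset by blast
  obtain \<sigma> where \<sigma>: "\<sigma> \<in> Sym n" "\<And>\<rho>. \<rho> \<in> R \<Longrightarrow> disjoint_perms n \<sigma> \<rho>"
    using latin_rectangle_extend_row[OF Suc.prems(1,2)] Suc.hyps(2)
    by (metis diff_is_0_eq not_le old.nat.distinct(2))
  \<comment> \<open>Some position exists, so no row is disjoint from itself and \<sigma> is
    new.\<close>
  have "1 \<in> {1..n}" using Suc.hyps(2) by auto
  then have "\<sigma> \<notin> R" using \<sigma>(2) unfolding disjoint_perms_def by blast
  then have c: "card (insert \<sigma> R) = Suc (card R)" using finR by simp
  have "\<exists>L\<in>one_factorizations n. insert \<sigma> R \<subseteq> L"
  proof (rule Suc.hyps(1))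
    show "pairwise (disjoint_perms n) (insert \<sigma> R)"
      using Suc.prems(2) \<sigma>(2) disjoint_perms_sym unfolding pairwise_insert by blast
  qed (use Suc \<sigma> c in auto)
  then show ?case by blast
qed

text \<open>Complete \<sigma>, \<tau> to a one-factorization and replace them by \<sigma>', \<tau>'.
  Each position keeps its pair of values, so the other rows remain disjoint from the new ones, and
  their contribution cancels when the two sums are compared.\<close>

lemma two_row_switch:
  fixes f :: "(nat \<Rightarrow> nat) \<Rightarrow> real"
  assumes const: "\<And>L L'. L \<in> one_factorizations n \<Longrightarrow> L' \<in> one_factorizations n \<Longrightarrow> sum f L = sum f L'"
    and n: "n \<ge> 2"
    and Sym: "\<sigma> \<in> Sym n" "\<tau> \<in> Sym n" "\<sigma>' \<in> Sym n" "\<tau>' \<in> Sym n"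
    and disj: "disjoint_perms n \<sigma> \<tau>"
    and switch: "\<And>i. i \<in> {1..n} \<Longrightarrow> {\<sigma>' i, \<tau>' i} = {\<sigma> i, \<tau> i}"
  shows "f \<sigma> + f \<tau> = f \<sigma>' + f \<tau>'"
proof -
  have one: "1 \<in> {1..n}" using n by simp
  have disj': "disjoint_perms n \<sigma>' \<tau>'"
    using disj switch unfolding disjoint_perms_def by (metis doubleton_eq_iff)
  have ne: "\<sigma> \<noteq> \<tau>" "\<sigma>' \<noteq> \<tau>'" using disj disj' one unfolding disjoint_perms_def by blast+
  have "\<exists>L\<in>one_factorizations n. {\<sigma>, \<tau>} \<subseteq> L"
    using disj disjoint_perms_sym Sym n ne
    by (intro latin_rectangle_extend) (auto simp: pairwise_insert)
  then obtain L where L: "L \<in> one_factorizations n" "\<sigma> \<in> L" "\<tau> \<in> L" by blast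
  define M where "M = L - {\<sigma>, \<tau>}"
  have finL: "finite L" using L(1) finite_Sym finite_subset unfolding one_factorizations_def by blast
  have pw: "pairwise (disjoint_perms n) L" and LS: "L \<subseteq> Sym n" and cL: "card L = n"
    using L(1) unfolding one_factorizations_def by auto
  have M: "finite M" "\<sigma> \<notin> M" "\<tau> \<notin> M" "L = insert \<sigma> (insert \<tau> M)"
    using finL L unfolding M_def by auto
  have d: "disjoint_perms n \<rho> \<sigma>'" "disjoint_perms n \<rho> \<tau>'" if "\<rho> \<in> M" for \<rho>
  proof -
    have "\<rho> i \<noteq> \<sigma> i \<and> \<rho> i \<noteq> \<tau> i" if "i \<in> {1..n}" for i
      using pairwise_disjoint_permsD[OF pw _ _ that] \<open>\<rho> \<in> M\<close> L M_def by blast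
    then show "disjoint_perms n \<rho> \<sigma>'" "disjoint_perms n \<rho> \<tau>'"
      using switch unfolding disjoint_perms_def by (metis doubleton_eq_iff)+
  qed
  then have nin: "\<sigma>' \<notin> M" "\<tau>' \<notin> M" using one unfolding disjoint_perms_def by blast+
  define L' where "L' = insert \<sigma>' (insert \<tau>' M)"
  have "L' \<in> one_factorizations n"
  proof -
    have "card L' = card L" unfolding L'_def M(4) using M nin ne by simp
    moreover have "pairwise (disjoint_perms n) M" using pw M(4) by (simp add: pairwise_insert)
    then have "pairwise (disjoint_perms n) L'"
      unfolding L'_def pairwise_insert using d disj' disjoint_perms_sym by blast
    ultimately show ?thesis
      using cL LS Sym M(4) unfolding one_factorizations_def L'_def by auto
  qed
  then have "sum f L = sum f L'" using const L by blast
  then show ?thesis unfolding L'_def M(4) using M nin ne by simp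
qed

text \<open>Composition on the right only permutes the columns of a Latin square.\<close>

lemma one_factorization_comp:
  assumes L: "L \<in> one_factorizations n" and \<pi>: "\<pi> \<in> Sym n"
  shows "(\<lambda>\<sigma>. \<sigma> \<circ> \<pi>) ` L \<in> one_factorizations n" and "inj_on (\<lambda>\<sigma>. \<sigma> \<circ> \<pi>) L"
proof -
  have p: "\<pi> permutes {1..n}" using \<pi> unfolding Sym_def by simp
  have "inj (\<lambda>\<sigma> :: nat \<Rightarrow> nat. \<sigma> \<circ> \<pi>)"
    by (rule injI) (metis comp_assoc comp_id permutes_inv_o(1)[OF p])
  then show inj: "inj_on (\<lambda>\<sigma>. \<sigma> \<circ> \<pi>) L" by (rule inj_on_subset) simp
  have "card ((\<lambda>\<sigma>. \<sigma> \<circ> \<pi>) ` L) = n"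
    using card_image[OF inj] L unfolding one_factorizations_def by simp
  moreover have "(\<lambda>\<sigma>. \<sigma> \<circ> \<pi>) ` L \<subseteq> Sym n"
    using L unfolding one_factorizations_def by (intro image_subsetI Sym_comp \<pi>) blast
  moreover have "pairwise (disjoint_perms n) ((\<lambda>\<sigma>. \<sigma> \<circ> \<pi>) ` L)"
    unfolding pairwise_image
  proof (rule pairwiseI, rule impI)
    fix \<sigma> \<tau> assume "\<sigma> \<in> L" "\<tau> \<in> L" "\<sigma> \<noteq> \<tau>"
    then have "disjoint_perms n \<sigma> \<tau>"
      using L unfolding one_factorizations_def pairwise_def by blast
    then show "disjoint_perms n (\<sigma> \<circ> \<pi>) (\<tau> \<circ> \<pi>)"
      unfolding disjoint_perms_def o_def by (metis Sym_in_iff[OF \<pi>])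
  qed
  ultimately show "(\<lambda>\<sigma>. \<sigma> \<circ> \<pi>) ` L \<in> one_factorizations n"
    unfolding one_factorizations_def by simp
qed

section \<open>Permutations with prescribed values and derangements\<close>

lemma exists_Sym_apply2:
  assumes "a \<in> {1..n}" "b \<in> {1..n}" "a \<noteq> b" "x \<in> {1..n}" "y \<in> {1..n}" "x \<noteq> y"
  shows "\<exists>\<sigma>\<in>Sym n. \<sigma> a = x \<and> \<sigma> b = y"
proof -
  let ?s = "transpose a x"
  have s: "?s \<in> Sym n" using assms by (intro Sym_transpose)
  have "?s b \<noteq> x" using assms(3) by (auto simp: transpose_eq_iff)
  then have "(transpose (?s b) y \<circ> ?s) a = x" using assms(6) by simp
  moreover have "transpose (?s b) y \<circ> ?s \<in> Sym n"
    using assms s Sym_in_iff[OF s] by (intro Sym_comp Sym_transpose) auto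
  ultimately show ?thesis by (intro bexI[of _ "transpose (?s b) y \<circ> ?s"]) auto
qed

lemma exists_Sym_apply3:
  assumes "a \<in> {1..n}" "b \<in> {1..n}" "c \<in> {1..n}" "a \<noteq> b" "a \<noteq> c" "b \<noteq> c"
    and "x \<in> {1..n}" "y \<in> {1..n}" "z \<in> {1..n}" "x \<noteq> y" "x \<noteq> z" "y \<noteq> z"
  shows "\<exists>\<sigma>\<in>Sym n. \<sigma> a = x \<and> \<sigma> b = y \<and> \<sigma> c = z"
proof -
  obtain s where s: "s \<in> Sym n" "s a = x" "s b = y"
    using exists_Sym_apply2[of a n b x y] assms by blast
  have ne: "s c \<noteq> x" "s c \<noteq> y" using Sym_inj_iff[OF s(1)] s assms(5,6) by metis+
  let ?s = "transpose (s c) z \<circ> s"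
  have "?s \<in> Sym n" using assms(3,9) s Sym_in_iff[OF s(1)] by (intro Sym_comp Sym_transpose) auto
  moreover have "?s a = x" "?s b = y" "?s c = z" using s ne assms(11,12) by auto
  ultimately show ?thesis by blast
qed

lemma cycle_of_list_nth:
  assumes "distinct cs" "i < length cs"
  shows "cycle_of_list cs (cs ! i) = cs ! (Suc i mod length cs)"
proof -
  have "map (cycle_of_list cs) cs = rotate1 cs"
    using cyclic_rotation[OF assms(1), of 1] by simp
  then have "cycle_of_list cs (cs ! i) = rotate1 cs ! i"
    using assms(2) by (metis nth_map)
  then show ?thesis using assms(2) by (simp add: nth_rotate1)
qed

text \<open>A cycle through all of B beginning c, p, d, q works. Composing it with (c d) creates a
  fixed point only if the cycle sends c to d or d to c, and the separators p and q prevent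
  both.\<close>

lemma exists_derangement_pair:
  assumes "finite B" "card B \<ge> 4" "c \<in> B" "d \<in> B" "c \<noteq> d"
  shows "\<exists>\<beta>. \<beta> permutes B \<and> (\<forall>i\<in>B. \<beta> i \<noteq> i) \<and> (\<forall>i\<in>B. transpose c d (\<beta> i) \<noteq> i)"
proof -
  have "card (B - {c, d}) \<ge> 2" using assms by (simp add: card_Diff_subset)
  then obtain T where T: "T \<subseteq> B - {c, d}" "card T = 2"
    using obtain_subset_with_card_n by metis
  obtain p q where "T = {p, q}" and "p \<noteq> q" using T(2) unfolding card_2_iff by auto
  then have pq: "p \<in> B - {c, d}" "q \<in> B - {c, d}" "p \<noteq> q" using T(1) by auto
  obtain rest where rest: "set rest = B - {c, d, p, q}" "distinct rest"
    using finite_distinct_list[OF finite_Diff[OF assms(1)]] by blast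
  define cs where "cs = c # p # d # q # rest"
  have cs: "distinct cs" "set cs = B" using rest pq assms unfolding cs_def by auto
  let ?\<beta> = "cycle_of_list cs"
  have c: "?\<beta> c = p" and d: "?\<beta> d = q"
    using cycle_of_list_nth[OF cs(1), of 0] cycle_of_list_nth[OF cs(1), of 2]
    unfolding cs_def by simp_all
  have nofix: "?\<beta> i \<noteq> i" if i: "i \<in> B" for i
  proof -
    obtain k where k: "k < length cs" "i = cs ! k" using i cs(2) by (metis in_set_conv_nth)
    have "Suc k mod length cs \<noteq> k" using k(1) unfolding cs_def by (auto simp: mod_Suc)
    moreover have "Suc k mod length cs < length cs" by (rule mod_less_divisor) (simp add: cs_def)
    ultimately have "cs ! (Suc k mod length cs) \<noteq> cs ! k"
      using cs(1) k(1) by (simp add: nth_eq_iff_index_eq)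
    then show ?thesis using cycle_of_list_nth[OF cs(1) k(1)] k(2) by simp
  qed
  have "transpose c d (?\<beta> i) \<noteq> i" if i: "i \<in> B" for i
  proof -
    have "?\<beta> i \<noteq> transpose c d i"
      using c d nofix[OF i] pq by (cases "i = c \<or> i = d") auto
    then show ?thesis by (metis transpose_involutory)
  qed
  then show ?thesis using cycle_permutes[of cs] cs(2) nofix by metis
qed

section \<open>Functions with constant sums over one-factorizations\<close>

locale constant_on_one_factorizations =
  fixes n :: nat and f :: "(nat \<Rightarrow> nat) \<Rightarrow> real"
  assumes n_ge_2: "n \<ge> 2"
    and sum_eq: "\<And>L L'. L \<in> one_factorizations n \<Longrightarrow> L' \<in> one_factorizations n \<Longrightarrow> sum f L = sum f L'"
begin

definition swap_diff :: "nat \<Rightarrow> nat \<Rightarrow> (nat \<Rightarrow> nat) \<Rightarrow> real" where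
  "swap_diff a b \<sigma> = f \<sigma> - f (\<sigma> \<circ> transpose a b)"

lemma swap_diff_swap_self: "swap_diff a b (\<sigma> \<circ> transpose a b) = - swap_diff a b \<sigma>"
  unfolding swap_diff_def by (simp add: comp_assoc)

lemma swap_diff_commute: "swap_diff b a \<sigma> = swap_diff a b \<sigma>"
  unfolding swap_diff_def by (simp add: transpose_commute)

text \<open>This global identity settles the small cases n = 5 and n = 3, where the general local
  arguments run out of points.\<close>

lemma sum_swap_diff_eq_0:
  assumes L: "L \<in> one_factorizations n" and ab: "a \<in> {1..n}" "b \<in> {1..n}"
  shows "(\<Sum>\<sigma>\<in>L. swap_diff a b \<sigma>) = 0"
proof -
  note comp = one_factorization_comp[OF L Sym_transpose[OF ab]]
  have "(\<Sum>\<sigma>\<in>L. f (\<sigma> \<circ> transpose a b)) = sum f ((\<lambda>\<sigma>. \<sigma> \<circ> transpose a b) ` L)"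
    using sum.reindex[OF comp(2), of f] by (simp add: o_def)
  also have "\<dots> = sum f L" by (rule sum_eq[OF comp(1) L])
  finally show ?thesis unfolding swap_diff_def by (simp add: sum_subtractf)
qed

text \<open>The rows \<sigma> and \<open>\<sigma> \<circ> \<beta> \<circ> transpose a b\<close> are
  disjoint, and exchanging their values in the positions a and b produces
  \<open>\<sigma> \<circ> transpose a b\<close> and \<open>\<sigma> \<circ> \<beta>\<close>.\<close>

lemma swap_diff_derangement:
  assumes ab: "a \<in> {1..n}" "b \<in> {1..n}" "a \<noteq> b" and \<sigma>: "\<sigma> \<in> Sym n"
    and \<beta>: "\<beta> permutes {1..n} - {a, b}" and nofix: "\<And>i. i \<in> {1..n} - {a, b} \<Longrightarrow> \<beta> i \<noteq> i"
  shows "swap_diff a b (\<sigma> \<circ> \<beta>) = swap_diff a b \<sigma>"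
proof -
  have \<beta>S: "\<beta> \<in> Sym n" using permutes_subset[OF \<beta>] unfolding Sym_def by blast
  have t: "transpose a b \<in> Sym n" using ab by (intro Sym_transpose)
  have fix_ab: "\<beta> a = a" "\<beta> b = b" using permutes_not_in[OF \<beta>] by auto
  have "f \<sigma> + f (\<sigma> \<circ> \<beta> \<circ> transpose a b) = f (\<sigma> \<circ> transpose a b) + f (\<sigma> \<circ> \<beta>)"
  proof (rule two_row_switch[OF sum_eq n_ge_2])
    show "disjoint_perms n \<sigma> (\<sigma> \<circ> \<beta> \<circ> transpose a b)"
      unfolding disjoint_perms_def
    proof
      fix i assume i: "i \<in> {1..n}"
      have "i \<noteq> \<beta> (transpose a b i)"
        using fix_ab ab nofix[of i] i by (cases "i = a \<or> i = b") auto
      then show "\<sigma> i \<noteq> (\<sigma> \<circ> \<beta> \<circ> transpose a b) i" using Sym_inj_iff[OF \<sigma>] by simp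
    qed
    fix i
    show "{(\<sigma> \<circ> transpose a b) i, (\<sigma> \<circ> \<beta>) i} = {\<sigma> i, (\<sigma> \<circ> \<beta> \<circ> transpose a b) i}"
      using fix_ab by (cases "i = a \<or> i = b") auto
  qed (use \<sigma> \<beta>S t in \<open>auto intro!: Sym_comp\<close>)
  then show ?thesis unfolding swap_diff_def by simp
qed

text \<open>For \<open>n \<ge> 6\<close> choose \<open>\<beta>\<close> such that \<open>\<beta>\<close> and \<open>(c d)\<beta>\<close> are both derangements of the complement of
  \<open>{a, b}\<close>; invariance under both gives invariance under the transposition. For \<open>n = 5\<close> the
  complement has three points, all its derangements are even, and this argument breaks down.\<close>

lemma swap_diff_swap_not5:
  assumes ab: "a \<in> {1..n}" "b \<in> {1..n}" "a \<noteq> b" and \<sigma>: "\<sigma> \<in> Sym n"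
    and cd: "c \<in> {1..n} - {a, b}" "d \<in> {1..n} - {a, b}" "c \<noteq> d" and n: "n \<noteq> 5"
  shows "swap_diff a b (\<sigma> \<circ> transpose c d) = swap_diff a b \<sigma>"
proof -
  let ?B = "{1..n} - {a, b}"
  have cardB: "card ?B = n - 2" using ab by (simp add: card_Diff_subset)
  have cd_B: "{c, d} \<subseteq> ?B" using cd by blast
  have "card {c, d} \<le> card ?B" by (rule card_mono) (use cd_B in auto)
  then have "n \<ge> 4" using cardB cd(3) n_ge_2 by auto
  show ?thesis
  proof (cases "n = 4")
    case True
    \<comment> \<open>For n = 4 the complement consists of c and d alone, and (c d) is itself a
      derangement of it.\<close>
    have eq: "?B = {c, d}" by (rule card_subset_eq[symmetric]) (use cd_B cd(3) cardB True in auto)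
    show ?thesis
    proof (rule swap_diff_derangement[OF ab \<sigma>])
      show "transpose c d permutes ?B" using cd(1,2) by (rule permutes_swap_id)
      show "transpose c d i \<noteq> i" if "i \<in> ?B" for i using that cd(3) unfolding eq by auto
    qed
  next
    case False
    have "card ?B \<ge> 4" using cardB False n \<open>n \<ge> 4\<close> by simp
    then obtain \<beta> where \<beta>: "\<beta> permutes ?B" "\<forall>i\<in>?B. \<beta> i \<noteq> i"
        "\<forall>i\<in>?B. transpose c d (\<beta> i) \<noteq> i"
      using exists_derangement_pair[of ?B c d] cd by auto
    have t: "transpose c d \<in> Sym n" using cd by (intro Sym_transpose) auto
    have "swap_diff a b (\<sigma> \<circ> transpose c d) = swap_diff a b (\<sigma> \<circ> transpose c d \<circ> \<beta>)"
      using \<beta> by (intro swap_diff_derangement[OF ab Sym_comp[OF \<sigma> t], symmetric]) auto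
    also have "\<dots> = swap_diff a b (\<sigma> \<circ> (transpose c d \<circ> \<beta>))" by (simp add: comp_assoc)
    also have "\<dots> = swap_diff a b \<sigma>"
      using \<beta>(3)
      by (intro swap_diff_derangement[OF ab \<sigma>]
        permutes_compose[OF \<beta>(1) permutes_swap_id[OF cd(1,2)]]) auto
    finally show ?thesis .
  qed
qed

text \<open>The mixed second difference of f along (a b) and (c d). Its vanishing for disjoint pairs
  is what remains to be proved when n = 5.\<close>

definition double_diff :: "nat \<Rightarrow> nat \<Rightarrow> nat \<Rightarrow> nat \<Rightarrow> (nat \<Rightarrow> nat) \<Rightarrow> real" where
  "double_diff a b c d \<sigma> = swap_diff a b \<sigma> - swap_diff a b (\<sigma> \<circ> transpose c d)"

lemma double_diff_commute: "double_diff b a c d \<sigma> = double_diff a b c d \<sigma>"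
  "double_diff a b d c \<sigma> = double_diff a b c d \<sigma>"
  unfolding double_diff_def by (simp_all add: swap_diff_commute transpose_commute)

lemma double_diff_exchange:
  assumes "a \<noteq> c" "a \<noteq> d" "b \<noteq> c" "b \<noteq> d"
  shows "double_diff c d a b \<sigma> = double_diff a b c d \<sigma>"
proof -
  have "transpose a b \<circ> transpose c d = transpose c d \<circ> transpose a b"
    using assms by (auto simp: fun_eq_iff transpose_def)
  then show ?thesis unfolding double_diff_def swap_diff_def by (simp add: comp_assoc)
qed

lemma double_diff_swap_right: "double_diff a b c d (\<sigma> \<circ> transpose c d) = - double_diff a b c d \<sigma>"
  unfolding double_diff_def by (simp add: comp_assoc)

section \<open>The exceptional case of five points\<close>

context
  assumes n5: "n = 5"
begin

abbreviation five :: "nat \<Rightarrow> nat \<Rightarrow> nat \<Rightarrow> nat \<Rightarrow> nat \<Rightarrow> bool" where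
  "five a b c d e \<equiv> distinct [a, b, c, d, e] \<and> {a, b, c, d, e} = {1..n}"

text \<open>The 3-cycle (c d)(c e) is a derangement of the complement of {a, b}, and multiplying it
  on the left by (c d) gives (c e). So the second pair may trade d for the fifth point.\<close>

lemma double_diff_shift:
  assumes five: "five a b c d e" and \<sigma>: "\<sigma> \<in> Sym n"
  shows "double_diff a b c e \<sigma> = double_diff a b c d \<sigma>"
proof -
  have B: "{1..n} - {a, b} = {c, d, e}" using five by auto
  have mem: "a \<in> {1..n}" "b \<in> {1..n}" "c \<in> {1..n}" "d \<in> {1..n}" "e \<in> {1..n}" "a \<noteq> b"
    using five by auto
  let ?\<beta> = "transpose c d \<circ> transpose c e"
  have "swap_diff a b (\<sigma> \<circ> transpose c d \<circ> ?\<beta>) = swap_diff a b (\<sigma> \<circ> transpose c d)"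
  proof (rule swap_diff_derangement)
    show "?\<beta> permutes {1..n} - {a, b}"
      unfolding B by (intro permutes_compose permutes_swap_id) auto
    show "?\<beta> i \<noteq> i" if "i \<in> {1..n} - {a, b}" for i
      using that five unfolding B by auto
    show "\<sigma> \<circ> transpose c d \<in> Sym n" using \<sigma> mem by (intro Sym_comp Sym_transpose)
  qed (use mem in auto)
  moreover have "\<sigma> \<circ> transpose c d \<circ> ?\<beta> = \<sigma> \<circ> transpose c e"
    by (simp add: fun_eq_iff)
  ultimately show ?thesis unfolding double_diff_def by simp
qed

lemma double_diff_swap_own:
  assumes five: "five a b c d e"
  shows "double_diff a b c d (\<sigma> \<circ> transpose a b) = - double_diff a b c d \<sigma>"
  using double_diff_swap_right[of c d a b \<sigma>] double_diff_exchange[of a c d b] five by simp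

text \<open>Exchange the pairs, then shift b to e: the pairs {a, b}, {c, d} become {c, d}, {a, e},
  and (a e) is now the right-hand transposition.\<close>

lemma double_diff_swap_fifth:
  assumes five: "five a b c d e" and \<sigma>: "\<sigma> \<in> Sym n"
  shows "double_diff a b c d (\<sigma> \<circ> transpose a e) = - double_diff a b c d \<sigma>"
proof -
  have five': "five c d a b e" using five by auto
  have "double_diff a b c d \<tau> = double_diff c d a e \<tau>" if "\<tau> \<in> Sym n" for \<tau>
    using double_diff_shift[OF five' that] double_diff_exchange[of a c d b] five by simp
  moreover have "\<sigma> \<circ> transpose a e \<in> Sym n" using five \<sigma> by (intro Sym_comp Sym_transpose) auto
  ultimately show ?thesis using \<sigma> by (simp add: double_diff_swap_right)
qed

text \<open>Two shifts bring (a c) to the right: the pairs pass from {a, b}, {c, d} to {a, b}, {d,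
  e}, and after an exchange to {d, e}, {a, c}.\<close>

lemma double_diff_swap_cross:
  assumes five: "five a b c d e" and \<sigma>: "\<sigma> \<in> Sym n"
  shows "double_diff a b c d (\<sigma> \<circ> transpose a c) = - double_diff a b c d \<sigma>"
proof -
  have f1: "five a b d c e" and f2: "five d e a b c" using five by auto
  have "double_diff a b c d \<tau> = double_diff d e a c \<tau>" if "\<tau> \<in> Sym n" for \<tau>
    using double_diff_shift[OF f1 that] double_diff_shift[OF f2 that]
      double_diff_exchange[of a d e b] double_diff_commute(2)[of a b c d] five
    by simp
  moreover have "\<sigma> \<circ> transpose a c \<in> Sym n" using five \<sigma> by (intro Sym_comp Sym_transpose) auto
  ultimately show ?thesis using \<sigma> by (simp add: double_diff_swap_right)
qed

lemma double_diff_swap: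
  assumes five: "five a b c d e" and \<sigma>: "\<sigma> \<in> Sym n"
    and pq: "p \<in> {1..n}" "q \<in> {1..n}" "p \<noteq> q"
  shows "double_diff a b c d (\<sigma> \<circ> transpose p q) = - double_diff a b c d \<sigma>"
proof -
  have fs: "five b a c d e" "five a b d c e" "five b a d c e" "five c d a b e" "five d c a b e"
    using five by auto
  have eqs: "double_diff b a c d \<tau> = double_diff a b c d \<tau>"
    "double_diff a b d c \<tau> = double_diff a b c d \<tau>" "double_diff b a d c \<tau> = double_diff a b c d \<tau>"
    "double_diff c d a b \<tau> = double_diff a b c d \<tau>"
      "double_diff d c a b \<tau> = double_diff a b c d \<tau>" for \<tau>
    using double_diff_exchange[of a c d b] double_diff_commute five by simp_all
  define P where "P x y \<longleftrightarrow> double_diff a b c d (\<sigma> \<circ> transpose x y) = - double_diff a b c d \<sigma>" for x y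
  have P_sym: "P y x \<longleftrightarrow> P x y" for x y unfolding P_def by (simp add: transpose_commute)
  \<comment> \<open>All ten transpositions of five points: the two pairs themselves, the four
    meeting e, and the four crossing between the pairs.\<close>
  have "P a b" "P c d" "P a e" "P b e" "P c e" "P d e" "P a c" "P b c" "P a d" "P b d"
    using double_diff_swap_own[OF five, of \<sigma>] double_diff_swap_right[of a b c d \<sigma>]
      double_diff_swap_fifth[OF five \<sigma>] double_diff_swap_fifth[OF fs(1) \<sigma>]
      double_diff_swap_fifth[OF fs(4) \<sigma>] double_diff_swap_fifth[OF fs(5) \<sigma>]
      double_diff_swap_cross[OF five \<sigma>] double_diff_swap_cross[OF fs(1) \<sigma>]
      double_diff_swap_cross[OF fs(2) \<sigma>] double_diff_swap_cross[OF fs(3) \<sigma>]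
    by (simp_all only: P_def eqs)
  note P = this
  have "p \<in> {a, b, c, d, e}" "q \<in> {a, b, c, d, e}" using five pq by auto
  then have "P p q"
    using pq(3) P P[THEN P_sym[THEN iffD2]] by (elim insertE emptyE)
      (simp_all only: not_True_eq_False simp_thms)
  then show ?thesis unfolding P_def .
qed

text \<open>The obstruction \<open>double_diff\<close> changes sign under every transposition, so it is a multiple of the
  sign character. It sums to zero over every one-factorization, whereas five signs have an odd sum.\<close>

lemma swap_diff_swap_5:
  assumes ab: "a \<in> {1..n}" "b \<in> {1..n}" "a \<noteq> b" and \<sigma>: "\<sigma> \<in> Sym n"
    and cd: "c \<in> {1..n} - {a, b}" "d \<in> {1..n} - {a, b}" "c \<noteq> d"
  shows "swap_diff a b (\<sigma> \<circ> transpose c d) = swap_diff a b \<sigma>"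
proof -
  have sub: "{a, b, c, d} \<subseteq> {1..n}" using ab cd by blast
  have "card ({1..n} - {a, b, c, d}) = 1"
    using n5 ab cd sub by (subst card_Diff_subset) auto
  then obtain e where e: "{1..n} - {a, b, c, d} = {e}" by (rule card_1_singletonE)
  have "e \<in> {1..n} - {a, b, c, d}" unfolding e by simp
  then have "distinct [a, b, c, d, e]" using ab(3) cd by simp blast
  moreover have "{1..n} = {a, b, c, d} \<union> {e}" using sub unfolding e[symmetric] by blast
  then have "{a, b, c, d, e} = {1..n}" by blast
  ultimately have five: "five a b c d e" by blast
  have double_diff_sign: "double_diff a b c d \<tau> = of_int (sign \<tau>) * double_diff a b c d id"
    if "\<tau> \<in> Sym n" for \<tau>
  proof -
    have "finite {1..n}" "\<tau> permutes {1..n}" using that unfolding Sym_def by simp_all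
    then show ?thesis
    proof (induction rule: permutes_rev_induct)
      case (swap p q \<rho>)
      have "sign (\<rho> \<circ> transpose p q) = - sign \<rho>"
        using swap permutes_imp_permutation[of "{1..n}" \<rho>]
        by (simp add: sign_compose permutation_swap_id sign_swap_id)
      moreover have "\<rho> \<in> Sym n" using swap unfolding Sym_def by simp
      ultimately show ?case using double_diff_swap[OF five, of \<rho> p q] swap.IH swap.hyps(1-3)
        by (simp only: of_int_minus mult_minus_left simp_thms)
    qed simp
  qed
  \<comment> \<open>Completing the empty rectangle shows that a one-factorization exists.\<close>
  obtain L where L: "L \<in> one_factorizations n"
    using latin_rectangle_extend[of "{}" n] by auto
  have LS: "L \<subseteq> Sym n" and cardL: "card L = n" using L unfolding one_factorizations_def by auto
  have t: "transpose c d \<in> Sym n" using cd by (intro Sym_transpose) auto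
  note comp = one_factorization_comp[OF L t]
  have "(\<Sum>\<tau>\<in>L. swap_diff a b (\<tau> \<circ> transpose c d))
    = sum (swap_diff a b) ((\<lambda>\<tau>. \<tau> \<circ> transpose c d) ` L)"
    using sum.reindex[OF comp(2), of "swap_diff a b"] by (simp add: o_def)
  also have "\<dots> = 0" by (rule sum_swap_diff_eq_0[OF comp(1) ab(1,2)])
  finally have "(\<Sum>\<tau>\<in>L. double_diff a b c d \<tau>) = 0"
    unfolding double_diff_def using sum_swap_diff_eq_0[OF L ab(1,2)] by (simp add: sum_subtractf)
  moreover have "(\<Sum>\<tau>\<in>L. double_diff a b c d \<tau>) = of_int (\<Sum>\<tau>\<in>L. sign \<tau>) * double_diff a b c d id"
    using LS double_diff_sign by (simp add: sum_distrib_right subset_iff)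
  moreover have "odd (\<Sum>\<tau>\<in>L. sign \<tau>)"
  proof -
    have "{\<tau> \<in> L. odd (sign \<tau>)} = L" by (auto simp: sign_def)
    moreover have "finite L" by (rule finite_subset[OF LS finite_Sym])
    ultimately show ?thesis using even_sum_iff[of L sign] cardL n5 by simp
  qed
  then have "(\<Sum>\<tau>\<in>L. sign \<tau>) \<noteq> 0" by (metis even_zero)
  ultimately have "double_diff a b c d id = 0" by (metis mult_eq_0_iff of_int_eq_0_iff)
  then have "double_diff a b c d \<sigma> = 0" using double_diff_sign[OF \<sigma>] by simp
  then show ?thesis unfolding double_diff_def by simp
qed

end

section \<open>Reduction to the values in two positions\<close>

lemma swap_diff_swap:
  assumes ab: "a \<in> {1..n}" "b \<in> {1..n}" "a \<noteq> b" and \<sigma>: "\<sigma> \<in> Sym n"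
    and cd: "c \<in> {1..n} - {a, b}" "d \<in> {1..n} - {a, b}"
  shows "swap_diff a b (\<sigma> \<circ> transpose c d) = swap_diff a b \<sigma>"
  using swap_diff_swap_not5[OF assms] swap_diff_swap_5[OF _ assms] by (cases "c = d") auto

text \<open>The quotient \<open>inv \<tau> \<circ> \<sigma>\<close> fixes a and b, hence is a
  product of transpositions of the complement, each of which leaves \<open>swap_diff a b\<close>
  unchanged.\<close>

lemma swap_diff_local:
  assumes ab: "a \<in> {1..n}" "b \<in> {1..n}" "a \<noteq> b" and Sym: "\<sigma> \<in> Sym n" "\<tau> \<in> Sym n"
    and eq: "\<sigma> a = \<tau> a" "\<sigma> b = \<tau> b"
  shows "swap_diff a b \<sigma> = swap_diff a b \<tau>"
proof -
  have p: "\<sigma> permutes {1..n}" "\<tau> permutes {1..n}" using Sym unfolding Sym_def by auto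
  let ?\<pi> = "inv \<tau> \<circ> \<sigma>"
  have "?\<pi> permutes {1..n} - {a, b}"
  proof (rule permutes_superset)
    show "?\<pi> permutes {1..n}" using p by (intro permutes_compose permutes_inv)
    fix i assume "i \<in> {1..n} - ({1..n} - {a, b})"
    then have "\<sigma> i = \<tau> i" using eq by auto
    then show "?\<pi> i = i" using permutes_inverses(2)[OF p(2)] by simp
  qed
  moreover have "swap_diff a b (\<tau> \<circ> \<pi>) = swap_diff a b \<tau>" if "\<pi> permutes {1..n} - {a, b}" for \<pi>
    using finite_Diff[OF finite_atLeastAtMost] that
  proof (induction rule: permutes_rev_induct)
    case (swap c d \<rho>)
    have "\<rho> \<in> Sym n" using permutes_subset[OF swap.hyps(4)] unfolding Sym_def by blast
    then have "swap_diff a b (\<tau> \<circ> \<rho> \<circ> transpose c d) = swap_diff a b (\<tau> \<circ> \<rho>)"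
      using swap.hyps(1,2) Sym_comp[OF Sym(2)] by (intro swap_diff_swap ab)
    then show ?case using swap.IH by (simp only: comp_assoc)
  qed simp_all
  ultimately have "swap_diff a b (\<tau> \<circ> ?\<pi>) = swap_diff a b \<tau>" by blast
  moreover have "\<tau> \<circ> ?\<pi> = \<sigma>" by (simp add: fun_eq_iff permutes_inverses(1)[OF p(2)])
  ultimately show ?thesis by simp
qed

text \<open>By \<open>swap_diff_local\<close> the choice of representative is immaterial for
  distinct positions in range. If no permutation has these values, as for x = y with a and b
  distinct, the result is unspecified; hence the distinctness hypotheses below.\<close>

definition diff_at :: "nat \<Rightarrow> nat \<Rightarrow> nat \<Rightarrow> nat \<Rightarrow> real" where
  "diff_at a b x y = swap_diff a b (SOME \<sigma>. \<sigma> \<in> Sym n \<and> \<sigma> a = x \<and> \<sigma> b = y)"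

lemma swap_diff_eq_diff_at:
  assumes ab: "a \<in> {1..n}" "b \<in> {1..n}" "a \<noteq> b" and \<sigma>: "\<sigma> \<in> Sym n"
  shows "swap_diff a b \<sigma> = diff_at a b (\<sigma> a) (\<sigma> b)"
proof -
  let ?P = "\<lambda>\<tau>. \<tau> \<in> Sym n \<and> \<tau> a = \<sigma> a \<and> \<tau> b = \<sigma> b"
  have "?P (SOME \<tau>. ?P \<tau>)" by (rule someI[of ?P \<sigma>]) (simp add: \<sigma>)
  then show ?thesis unfolding diff_at_def using \<sigma> by (intro swap_diff_local[OF ab]) auto
qed

section \<open>Relations among the differences and their integration\<close>

lemma diff_at_swap:
  assumes ab: "a \<in> {1..n}" "b \<in> {1..n}" "a \<noteq> b" and xy: "x \<in> {1..n}" "y \<in> {1..n}" "x \<noteq> y"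
  shows "diff_at a b y x = - diff_at a b x y" and "diff_at b a y x = diff_at a b x y"
proof -
  obtain \<sigma> where \<sigma>: "\<sigma> \<in> Sym n" "\<sigma> a = x" "\<sigma> b = y"
    using exists_Sym_apply2[OF ab xy] by blast
  have t: "\<sigma> \<circ> transpose a b \<in> Sym n" using ab \<sigma> by (intro Sym_comp Sym_transpose)
  show "diff_at a b y x = - diff_at a b x y"
    using swap_diff_swap_self[of a b \<sigma>] swap_diff_eq_diff_at[OF ab \<sigma>(1)]
      swap_diff_eq_diff_at[OF ab t] \<sigma> by simp
  show "diff_at b a y x = diff_at a b x y"
    using swap_diff_commute[of b a \<sigma>] swap_diff_eq_diff_at[OF ab \<sigma>(1)]
      swap_diff_eq_diff_at[OF ab(2,1) ab(3)[symmetric] \<sigma>(1)] \<sigma> by simp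
qed

text \<open>Both sides equal f(\<sigma>) - f(\<sigma>(a c)): the left side telescopes along the
  factorization (a c) = (a b)(b c)(a b).\<close>

lemma diff_at_braid:
  assumes abc: "a \<in> {1..n}" "b \<in> {1..n}" "c \<in> {1..n}" "a \<noteq> b" "a \<noteq> c" "b \<noteq> c"
    and xyz: "x \<in> {1..n}" "y \<in> {1..n}" "z \<in> {1..n}" "x \<noteq> y" "x \<noteq> z" "y \<noteq> z"
  shows "diff_at a b x y + diff_at b c x z + diff_at a b y z = diff_at a c x z"
proof -
  obtain \<sigma> where \<sigma>: "\<sigma> \<in> Sym n" "\<sigma> a = x" "\<sigma> b = y" "\<sigma> c = z"
    using exists_Sym_apply3[OF abc xyz] by blast
  let ?\<sigma>1 = "\<sigma> \<circ> transpose a b" and ?\<sigma>2 = "\<sigma> \<circ> transpose a b \<circ> transpose b c"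
  have S: "?\<sigma>1 \<in> Sym n" "?\<sigma>2 \<in> Sym n" using abc \<sigma>(1) by (simp_all only: Sym_comp Sym_transpose)
  have "?\<sigma>2 \<circ> transpose a b = \<sigma> \<circ> transpose a c"
    using transpose_comp_triple[of a c b] abc(5,6) by (simp add: comp_assoc)
  then have "swap_diff a b \<sigma> + swap_diff b c ?\<sigma>1 + swap_diff a b ?\<sigma>2 = swap_diff a c \<sigma>"
    unfolding swap_diff_def by simp
  moreover have "swap_diff a b \<sigma> = diff_at a b x y" "swap_diff a c \<sigma> = diff_at a c x z"
    using swap_diff_eq_diff_at[OF _ _ _ \<sigma>(1)] abc \<sigma>(2-4) by simp_all
  moreover have "swap_diff b c ?\<sigma>1 = diff_at b c x z"
    using swap_diff_eq_diff_at[OF abc(2,3,6) S(1)] abc \<sigma>(2-4) by simp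
  moreover have "swap_diff a b ?\<sigma>2 = diff_at a b y z"
    using swap_diff_eq_diff_at[OF abc(1,2,4) S(2)] abc \<sigma>(2-4) by simp
  ultimately show ?thesis by simp
qed

text \<open>Three values leave no fourth one for the general argument. Instead \<sigma> and its two
  cyclic shifts form a one-factorization, over which \<open>swap_diff\<close> sums to zero.\<close>

lemma diff_at_cycle_3:
  assumes n3: "n = 3" and ab: "a \<in> {1..n}" "b \<in> {1..n}" "a \<noteq> b"
    and xyz: "x \<in> {1..n}" "y \<in> {1..n}" "z \<in> {1..n}" "x \<noteq> y" "x \<noteq> z" "y \<noteq> z"
  shows "diff_at a b x y + diff_at a b y z + diff_at a b z x = 0"
proof -
  have "card ({1..n} - {a, b}) = 1" using n3 ab by (subst card_Diff_subset) auto
  then obtain c where c: "{1..n} - {a, b} = {c}" by (rule card_1_singletonE)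
  then have c': "c \<in> {1..n} - {a, b}" by simp
  then have abc: "c \<in> {1..n}" "a \<noteq> c" "b \<noteq> c" by auto
  have univ: "{1..n} = {a, b} \<union> {c}" using ab unfolding c[symmetric] by blast
  obtain \<sigma> where \<sigma>: "\<sigma> \<in> Sym n" "\<sigma> a = x" "\<sigma> b = y" "\<sigma> c = z"
    using exists_Sym_apply3[OF ab(1,2) abc(1) ab(3) abc(2,3) xyz] by blast
  \<comment> \<open>This 3-cycle sends a to b, b to c and c to a, so it shifts the values (x, y, z)
    to (y, z, x).\<close>
  let ?\<rho> = "transpose a b \<circ> transpose b c"
  have \<rho>: "?\<rho> \<in> Sym n" using ab abc by (intro Sym_comp Sym_transpose)
  define \<tau> \<upsilon> where "\<tau> = \<sigma> \<circ> ?\<rho>" and "\<upsilon> = \<tau> \<circ> ?\<rho>"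
  have \<tau>: "\<tau> \<in> Sym n" "\<tau> a = y" "\<tau> b = z" "\<tau> c = x"
    unfolding \<tau>_def using \<sigma> ab(3) abc Sym_comp[OF \<sigma>(1) \<rho>] by simp_all
  have \<upsilon>: "\<upsilon> \<in> Sym n" "\<upsilon> a = z" "\<upsilon> b = x" "\<upsilon> c = y"
    unfolding \<upsilon>_def using \<tau> ab(3) abc Sym_comp[OF \<tau>(1) \<rho>] by simp_all
  have disj: "disjoint_perms n \<sigma> \<tau>" "disjoint_perms n \<sigma> \<upsilon>" "disjoint_perms n \<tau> \<upsilon>"
    unfolding disjoint_perms_def univ using \<sigma>(2-4) \<tau>(2-4) \<upsilon>(2-4) xyz(4-6) by auto
  have ne: "\<sigma> \<noteq> \<tau>" "\<sigma> \<noteq> \<upsilon>" "\<tau> \<noteq> \<upsilon>" using \<sigma>(2) \<tau>(2) \<upsilon>(2) xyz(4-6) by auto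
  have L: "{\<sigma>, \<tau>, \<upsilon>} \<in> one_factorizations n"
    unfolding one_factorizations_def
    using \<sigma>(1) \<tau>(1) \<upsilon>(1) disj disj[THEN disjoint_perms_sym] ne n3 by (auto simp: pairwise_insert)
  have "(\<Sum>\<pi>\<in>{\<sigma>, \<tau>, \<upsilon>}. swap_diff a b \<pi>) = swap_diff a b \<sigma> + (swap_diff a b \<tau> + swap_diff a b \<upsilon>)"
    using ne by simp
  then show ?thesis
    using sum_swap_diff_eq_0[OF L ab(1,2)] swap_diff_eq_diff_at[OF ab \<sigma>(1)]
      swap_diff_eq_diff_at[OF ab \<tau>(1)] swap_diff_eq_diff_at[OF ab \<upsilon>(1)]
      \<sigma>(2,3) \<tau>(2,3) \<upsilon>(2,3) by simp
qed

text \<open>For \<open>n \<ge> 4\<close> the braid relation makes the cyclic sum independent of each of its arguments;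
  being alternating, it vanishes.\<close>

lemma diff_at_cycle:
  assumes ab: "a \<in> {1..n}" "b \<in> {1..n}" "a \<noteq> b"
    and xyz: "x \<in> {1..n}" "y \<in> {1..n}" "z \<in> {1..n}" "x \<noteq> y" "x \<noteq> z" "y \<noteq> z"
  shows "diff_at a b x y + diff_at a b y z + diff_at a b z x = 0"
proof (cases "n = 3")
  case True
  then show ?thesis using diff_at_cycle_3 assms by blast
next
  case False
  have "card {x, y, z} \<le> card {1..n}" by (rule card_mono) (use xyz in auto)
  then have n: "n \<ge> 4" using False xyz by simp
  have "card ({1..n} - {a, b}) > 0" "card ({1..n} - {x, y, z}) > 0"
    using n diff_card_le_card_Diff[of "{a, b}" "{1..n}"]
      diff_card_le_card_Diff[of "{x, y, z}" "{1..n}"]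
      ab(3) xyz(4-6) by simp_all
  then obtain c w where "c \<in> {1..n} - {a, b}" "w \<in> {1..n} - {x, y, z}"
    by (metis card_gt_0_iff ex_in_conv)
  then have c: "c \<in> {1..n}" "a \<noteq> c" "b \<noteq> c" and w: "w \<in> {1..n}" "w \<noteq> x" "w \<noteq> y" "w \<noteq> z"
    by auto
  define k where "k u v = diff_at a c u v - diff_at b c u v" for u v
  \<comment> \<open>The braid relation with the third position c shows that a two-step sum from u to
    t does not depend on the middle value v.\<close>
  have through: "diff_at a b u v + diff_at a b v t = k u t"
    if "u \<in> {1..n}" "v \<in> {1..n}" "t \<in> {1..n}" "u \<noteq> v" "u \<noteq> t" "v \<noteq> t" for u v t
    using diff_at_braid[OF ab(1,2) c(1) ab(3) c(2,3) that] unfolding k_def by simp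
  have anti: "diff_at a b v u = - diff_at a b u v" if "u \<in> {1..n}" "v \<in> {1..n}" "u \<noteq> v" for u v
    using diff_at_swap(1)[OF ab that] .
  \<comment> \<open>Three changes of the middle value, passing through w, turn the cyclic sum along
    x, y, z into the one along x, z, y, which is its negative.\<close>
  have "diff_at a b x y + diff_at a b y z = diff_at a b x w + diff_at a b w z"
    using through[of x y z] through[of x w z] xyz w by simp
  moreover have "diff_at a b w z + diff_at a b z x = diff_at a b w y + diff_at a b y x"
    using through[of w z x] through[of w y x] xyz w by simp
  moreover have "diff_at a b x w + diff_at a b w y = diff_at a b x z + diff_at a b z y"
    using through[of x w y] through[of x z y] xyz w by simp
  ultimately show ?thesis
    using anti[of x y] anti[of y z] anti[of x z] xyz by simp
qed

text \<open>The solution normalized to vanish at position 1 and at value 1. The explicit zeros also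
  avoid unspecified values of \<open>diff_at\<close> at equal positions or equal values.\<close>

definition potential :: "nat \<Rightarrow> nat \<Rightarrow> real" where
  "potential a x = (if a = 1 \<or> x = 1 then 0 else diff_at a 1 x 1)"

text \<open>The cycle relation through the value 1 settles b = 1. The braid relation with third
  position 1 then reduces any pair (a, b) to (a, 1) and (b, 1).\<close>

lemma diff_at_eq_potential:
  assumes ab: "a \<in> {1..n}" "b \<in> {1..n}" "a \<noteq> b" and xy: "x \<in> {1..n}" "y \<in> {1..n}" "x \<noteq> y"
  shows "diff_at a b x y = potential a x - potential a y - potential b x + potential b y"
proof -
  have one: "1 \<in> {1..n}" using n_ge_2 by simp
  have potential_1: "potential 1 u = 0" for u unfolding potential_def by simp
  have base: "diff_at c 1 u v = potential c u - potential c v"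
    if "c \<in> {1..n}" "c \<noteq> 1" "u \<in> {1..n}" "v \<in> {1..n}" "u \<noteq> v" for c u v
  proof (cases "u = 1 \<or> v = 1")
    case True
    then show ?thesis
      using diff_at_swap(1)[OF that(1) one that(2) that(3-5)] that unfolding potential_def by auto
  next
    case False
    then show ?thesis
      using diff_at_cycle[OF that(1) one that(2), of u v 1]
        diff_at_swap(1)[OF that(1) one that(2), of u 1] that one
      unfolding potential_def by simp
  qed
  consider "a = 1" | "b = 1" | "a \<noteq> 1" "b \<noteq> 1" by blast
  then show ?thesis
  proof cases
    case 1
    then show ?thesis
      using base[of b y x] diff_at_swap(2)[OF ab xy] ab xy potential_1 by simp
  next
    case 2
    then show ?thesis using base[of a x y] ab xy potential_1 by simp
  next
    case 3
    \<comment> \<open>Three distinct positions force n \<ge> 3, which leaves a value z besides x and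
      y to serve as the middle value in the braid relation.\<close>
    have "card {a, b, 1} \<le> card {1..n}" by (rule card_mono) (use ab one in auto)
    then have "n \<ge> 3" using ab(3) 3 by simp
    then have "card ({1..n} - {x, y}) > 0"
      using diff_card_le_card_Diff[of "{x, y}" "{1..n}"] xy(3) by simp
    then obtain z where "z \<in> {1..n} - {x, y}" by (metis card_gt_0_iff ex_in_conv)
    then have z: "z \<in> {1..n}" "z \<noteq> x" "z \<noteq> y" by auto
    have "diff_at a b x z + diff_at b 1 x y + diff_at a b z y = diff_at a 1 x y"
      using diff_at_braid[OF ab(1,2) one ab(3) 3 xy(1) z(1) xy(2)] z xy by simp
    moreover have "diff_at a b x z + diff_at a b z y + diff_at a b y x = 0"
      using diff_at_cycle[OF ab xy(1) z(1) xy(2)] z xy by simp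
    ultimately have "diff_at a b x y = diff_at a 1 x y - diff_at b 1 x y"
      using diff_at_swap(1)[OF ab xy] by simp
    then show ?thesis using base[of a x y] base[of b x y] 3 ab xy by simp
  qed
qed

lemma additive_form:
  assumes "\<sigma> \<in> Sym n"
  shows "f \<sigma> = (f id - (\<Sum>i=1..n. potential i i)) + (\<Sum>i=1..n. potential i (\<sigma> i))"
proof -
  define h where "h \<tau> = f \<tau> - (\<Sum>i=1..n. potential i (\<tau> i))" for \<tau>
  have "finite {1..n}" "\<sigma> permutes {1..n}" using assms unfolding Sym_def by simp_all
  then have "h \<sigma> = h id"
  proof (induction rule: permutes_rev_induct)
    case (swap a b \<rho>)
    note ab = swap.hyps(1,2,3)
    have \<rho>: "\<rho> \<in> Sym n" using swap.hyps(4) unfolding Sym_def by simp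
    have xy: "\<rho> a \<in> {1..n}" "\<rho> b \<in> {1..n}" "\<rho> a \<noteq> \<rho> b"
      using ab Sym_in_iff[OF \<rho>] Sym_inj_iff[OF \<rho>] by blast+
    \<comment> \<open>Passing to \<open>\<rho> \<circ> transpose a b\<close> affects only the
      summands at a and b.\<close>
    have split: "(\<Sum>i=1..n. F i) = F a + (F b + sum F ({1..n} - {a} - {b}))" for F :: "nat \<Rightarrow> real"
      using ab by (simp add: sum.remove[of _ a] sum.remove[of _ b])
    have "(\<Sum>i\<in>{1..n} - {a} - {b}. potential i ((\<rho> \<circ> transpose a b) i))
      = (\<Sum>i\<in>{1..n} - {a} - {b}. potential i (\<rho> i))"
      by (rule sum.cong) auto
    then have "(\<Sum>i=1..n. potential i (\<rho> i)) - (\<Sum>i=1..n. potential i ((\<rho> \<circ> transpose a b) i))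
        = potential a (\<rho> a) + potential b (\<rho> b) - potential a (\<rho> b) - potential b (\<rho> a)"
      unfolding split[of "\<lambda>i. potential i (\<rho> i)"]
        split[of "\<lambda>i. potential i ((\<rho> \<circ> transpose a b) i)"] by simp
    moreover have "f \<rho> - f (\<rho> \<circ> transpose a b) = diff_at a b (\<rho> a) (\<rho> b)"
      using swap_diff_eq_diff_at[OF ab \<rho>] unfolding swap_diff_def by simp
    ultimately have "h (\<rho> \<circ> transpose a b) = h \<rho>"
      unfolding h_def using diff_at_eq_potential[OF ab xy] by linarith
    then show ?case using swap.IH by (simp only:)
  qed simp
  then show ?thesis unfolding h_def by simp
qed

end

section \<open>The spaces U and T\<close>

lemma sum_fun_apply: "sum F A x = (\<Sum>i\<in>A. F i x)"
  by (induction A rule: infinite_finite_induct) simp_all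

text \<open>Disjointness makes evaluation at i injective on L, and n distinct values exhaust {1..n}:
  every column of a Latin square is a permutation.\<close>

lemma sum_one_factorization_coordinate:
  assumes L: "L \<in> one_factorizations n" and i: "i \<in> {1..n}"
  shows "(\<Sum>\<sigma>\<in>L. h (\<sigma> i)) = sum h {1..n}"
proof -
  have LS: "L \<subseteq> Sym n" and card: "card L = n" and pw: "pairwise (disjoint_perms n) L"
    using L unfolding one_factorizations_def by auto
  have inj: "inj_on (\<lambda>\<sigma>. \<sigma> i) L"
    by (rule inj_onI) (rule pairwise_disjoint_permsD[OF pw _ _ i])
  have "(\<lambda>\<sigma>. \<sigma> i) ` L \<subseteq> {1..n}"
  proof (rule image_subsetI)
    fix \<sigma> assume "\<sigma> \<in> L"
    then have "\<sigma> \<in> Sym n" using LS by blast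
    then show "\<sigma> i \<in> {1..n}" using Sym_in_iff i by blast
  qed
  then have "(\<lambda>\<sigma>. \<sigma> i) ` L = {1..n}"
    by (intro card_subset_eq) (simp_all add: card_image[OF inj] card)
  then show ?thesis using sum.reindex[OF inj, of h] by (simp add: o_def)
qed

text \<open>The right-hand side does not involve L; this is the easy direction of the
  theorem.\<close>

lemma sum_one_factorization_additive:
  fixes c :: real and a :: "nat \<Rightarrow> nat \<Rightarrow> real"
  assumes L: "L \<in> one_factorizations n"
    and f: "\<And>\<sigma>. \<sigma> \<in> Sym n \<Longrightarrow> f \<sigma> = c + (\<Sum>i=1..n. a i (\<sigma> i))"
  shows "sum f L = n * c + (\<Sum>i=1..n. \<Sum>j=1..n. a i j)"
proof -
  have LS: "L \<subseteq> Sym n" and card: "card L = n" using L unfolding one_factorizations_def by auto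
  have "sum f L = (\<Sum>\<sigma>\<in>L. c + (\<Sum>i=1..n. a i (\<sigma> i)))"
    by (rule sum.cong[OF refl], rule f) (use LS in blast)
  also have "\<dots> = n * c + (\<Sum>i=1..n. \<Sum>\<sigma>\<in>L. a i (\<sigma> i))"
    using card sum.swap[of "\<lambda>\<sigma> i. a i (\<sigma> i)" "{1..n}" L] by (simp add: sum.distrib)
  also have "(\<Sum>i=1..n. \<Sum>\<sigma>\<in>L. a i (\<sigma> i)) = (\<Sum>i=1..n. \<Sum>j=1..n. a i j)"
    by (rule sum.cong[OF refl]) (rule sum_one_factorization_coordinate[OF L])
  finally show ?thesis .
qed

lemma U_space_subset_fun_space: "U_space n \<subseteq> fun_space n"
  unfolding U_space_def
proof (rule span_minimal)
  show "subspace (fun_space n)"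
    unfolding fun_space_def subspace_def by (simp add: scaleR_fun_def)
  show "{x_fun n i j | i j. i \<in> {1..n} \<and> j \<in> {1..n}} \<subseteq> fun_space n"
    unfolding fun_space_def x_fun_def by auto
qed

lemma U_space_additive:
  assumes "f \<in> U_space n"
  shows "\<exists>a. \<forall>\<sigma>\<in>Sym n. f \<sigma> = (\<Sum>i=1..n. a i (\<sigma> i))"
  using assms unfolding U_space_def
proof (induction rule: span_induct_alt)
  case base
  show ?case by (intro exI[of _ "\<lambda>_ _. 0"]) simp
next
  case (step r x y)
  from step obtain i j where x: "x = x_fun n i j" and i: "i \<in> {1..n}" by blast
  from step obtain a where a: "\<And>\<sigma>. \<sigma> \<in> Sym n \<Longrightarrow> y \<sigma> = (\<Sum>i=1..n. a i (\<sigma> i))" by blast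
  show ?case
  proof (intro exI ballI)
    fix \<sigma> assume \<sigma>: "\<sigma> \<in> Sym n"
    \<comment> \<open>Adding r times the generator raises the single coefficient at (i, j) by
      r.\<close>
    have "(\<Sum>k=1..n. if k = i then if \<sigma> k = j then r else 0 else 0) = r * x \<sigma>"
      using i \<sigma> unfolding x x_fun_def by simp
    then show "(r *\<^sub>R x + y) \<sigma> =
        (\<Sum>k=1..n. (if k = i then if \<sigma> k = j then r else 0 else 0) + a k (\<sigma> k))"
      unfolding sum.distrib using a[OF \<sigma>] by (simp add: scaleR_fun_def)
  qed
qed

lemma additive_in_U_space:
  assumes n: "n \<ge> 1" and f0: "f \<in> fun_space n"
    and f: "\<And>\<sigma>. \<sigma> \<in> Sym n \<Longrightarrow> f \<sigma> = c + (\<Sum>i=1..n. a i (\<sigma> i))"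
  shows "f \<in> U_space n"
proof -
  \<comment> \<open>The constant is absorbed into the first row, because every permutation meets it exactly once.\<close>
  define b where "b i j = a i j + (if i = 1 then c else 0)" for i j
  have "f = (\<Sum>i=1..n. \<Sum>j=1..n. b i j *\<^sub>R x_fun n i j)"
  proof
    fix \<sigma>
    show "f \<sigma> = (\<Sum>i=1..n. \<Sum>j=1..n. b i j *\<^sub>R x_fun n i j) \<sigma>"
    proof (cases "\<sigma> \<in> Sym n")
      case True
      have "(\<Sum>j=1..n. b i j * x_fun n i j \<sigma>) = b i (\<sigma> i)" if "i \<in> {1..n}" for i
      proof -
        have "\<sigma> i \<in> {1..n}" using Sym_in_iff[OF True] that by blast
        moreover have "(\<Sum>j=1..n. b i j * x_fun n i j \<sigma>) = (\<Sum>j=1..n. if j = \<sigma> i then b i j else 0)"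
          using True unfolding x_fun_def by (intro sum.cong) auto
        ultimately show ?thesis by simp
      qed
      then have "(\<Sum>i=1..n. \<Sum>j=1..n. b i j *\<^sub>R x_fun n i j) \<sigma> = (\<Sum>i=1..n. b i (\<sigma> i))"
        by (simp add: sum_fun_apply scaleR_fun_def)
      also have "\<dots> = c + (\<Sum>i=1..n. a i (\<sigma> i))"
        using n unfolding b_def sum.distrib by simp
      finally show ?thesis using f[OF True] by simp
    next
      case False
      then show ?thesis
        using f0 unfolding fun_space_def x_fun_def by (simp add: sum_fun_apply scaleR_fun_def)
    qed
  qed
  moreover have "(\<Sum>i=1..n. \<Sum>j=1..n. b i j *\<^sub>R x_fun n i j) \<in> U_space n"
    unfolding U_space_def by (intro span_sum span_scale span_base) blast
  ultimately show ?thesis by simp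
qed

text \<open>The functions orthogonal to f form a subspace, so orthogonality need only be tested on
  the generators, where the inner product is a difference of two sums over
  one-factorizations.\<close>

lemma orth_T_space_iff:
  "f \<in> orth_Sym n (T_space n) \<longleftrightarrow> f \<in> fun_space n \<and>
    (\<forall>L\<in>one_factorizations n. \<forall>L'\<in>one_factorizations n. sum f L = sum f L')"
proof -
  let ?S = "{indicator L - indicator L' | L L'. L \<in> one_factorizations n \<and> L' \<in> one_factorizations n}
    :: ((nat \<Rightarrow> nat) \<Rightarrow> real) set"
  have sub: "subspace {h. inner_Sym n f h = 0}"
    unfolding subspace_def inner_Sym_def
    by (simp add: scaleR_fun_def distrib_left sum.distrib mult.left_commute flip: sum_distrib_left)
  have ind: "(\<Sum>\<sigma>\<in>Sym n. f \<sigma> * indicator L \<sigma>) = sum f L" if "L \<in> one_factorizations n" for L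
    using that unfolding one_factorizations_def by (auto simp: sum_indicator_eq_card
      Int_absorb1 sum.inter_restrict[symmetric] indicator_def if_distrib cong: if_cong)
  have inner: "inner_Sym n f (indicator L - indicator L') = sum f L - sum f L'"
    if "L \<in> one_factorizations n" "L' \<in> one_factorizations n" for L L'
    unfolding inner_Sym_def using ind[OF that(1)] ind[OF that(2)]
    by (simp add: right_diff_distrib sum_subtractf)
  have "(\<forall>h\<in>?S. inner_Sym n f h = 0) \<longleftrightarrow> (\<forall>L\<in>one_factorizations n. \<forall>L'\<in>one_factorizations n.
      inner_Sym n f (indicator L - indicator L') = 0)"
    by blast
  also have "\<dots> \<longleftrightarrow> (\<forall>L\<in>one_factorizations n. \<forall>L'\<in>one_factorizations n. sum f L = sum f L')"
    by (intro ball_cong refl) (simp only: inner right_minus_eq)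
  finally have "(\<forall>h\<in>?S. inner_Sym n f h = 0) \<longleftrightarrow>
      (\<forall>L\<in>one_factorizations n. \<forall>L'\<in>one_factorizations n. sum f L = sum f L')" .
  moreover have "(\<forall>h\<in>T_space n. inner_Sym n f h = 0) \<longleftrightarrow> (\<forall>h\<in>?S. inner_Sym n f h = 0)"
    unfolding T_space_def using span_minimal[OF _ sub, of ?S] span_superset[of ?S] by blast
  ultimately show ?thesis unfolding orth_Sym_def by simp
qed

theorem theorem1p2:
  fixes n :: nat
  assumes "n \<ge> 2"
  shows "U_space n = orth_Sym n (T_space n) \<and>
    (\<forall>f\<in>fun_space n.
       (f \<in> U_space n \<longleftrightarrow>
          (\<forall>L\<in>one_factorizations n. \<forall>L'\<in>one_factorizations n.
             (\<Sum>\<sigma>\<in>L. f \<sigma>) = (\<Sum>\<sigma>\<in>L'. f \<sigma>))) \<and>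
       (f \<in> U_space n \<longleftrightarrow>
          (\<exists>(c::real) (a :: nat \<Rightarrow> nat \<Rightarrow> real). \<forall>\<sigma>\<in>Sym n.
             f \<sigma> = c + (\<Sum>i=1..n. a i (\<sigma> i)))))"
proof -
  let ?const = "\<lambda>f :: (nat \<Rightarrow> nat) \<Rightarrow> real. \<forall>L\<in>one_factorizations n. \<forall>L'\<in>one_factorizations n. sum f L = sum f L'"
  let ?add = "\<lambda>f. \<exists>(c::real) (a :: nat \<Rightarrow> nat \<Rightarrow> real). \<forall>\<sigma>\<in>Sym n. f \<sigma> = c + (\<Sum>i=1..n. a i (\<sigma> i))"
  have U_add: "?add f" if "f \<in> U_space n" for f
    using U_space_additive[OF that] by (metis add_0)
  have add_U: "f \<in> U_space n" if f0: "f \<in> fun_space n" and "?add f" for f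
  proof -
    obtain c a where "\<forall>\<sigma>\<in>Sym n. f \<sigma> = c + (\<Sum>i=1..n. a i (\<sigma> i))" using \<open>?add f\<close> by blast
    then show ?thesis using additive_in_U_space[OF _ f0, of c a] assms by simp
  qed
  have add_const: "?const f" if "?add f" for f
  proof -
    obtain c a where "\<forall>\<sigma>\<in>Sym n. f \<sigma> = c + (\<Sum>i=1..n. a i (\<sigma> i))" using \<open>?add f\<close> by blast
    then show ?thesis using sum_one_factorization_additive[of _ n f c a] by simp
  qed
  have const_add: "?add f" if "?const f" for f
  proof -
    \<comment> \<open>The hard direction: the potentials serve as the coefficients.\<close>
    interpret constant_on_one_factorizations n f
      by unfold_locales (use assms that in blast)+
    show ?thesis using additive_form by blast
  qed
  have U_iff: "f \<in> U_space n \<longleftrightarrow> f \<in> fun_space n \<and> ?const f" for f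
    using U_add add_U add_const const_add U_space_subset_fun_space by blast
  have "U_space n = orth_Sym n (T_space n)"
    using U_iff orth_T_space_iff by blast
  moreover have "(f \<in> U_space n \<longleftrightarrow> ?const f) \<and> (f \<in> U_space n \<longleftrightarrow> ?add f)" if "f \<in> fun_space n" for f
    using U_iff U_add add_U that by blast
  ultimately show ?thesis by blast
qed

end
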